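(* Let $T$ be a Hausdorff topological monoid with unit $1_T$ which contains the extended bicyclic semigroup $\mathscr{C}_{\mathbb{Z}}$ as a dense subsemigroup, and let $H(1_T)$ be the group of units of $T$. Then: (i) there exists an open neighbourhood $U(1_T)$ of the unit $1_T$ in $T$ such that $U(1_T)\cap\mathscr{C}_{\mathbb{Z}}\subseteq E(\mathscr{C}_{\mathbb{Z}})$; and if the group of units $H(1_T)$ of $T$ is non-singleton, then: (ii) for every $x\in H(1_T)$ there exists an open neighbourhood $U(x)$ of $x$ in $T$ such that $a-b=c-d$ for all $(a,b),(c,d)\in U(x)\cap\mathscr{C}_{\mathbb{Z}}$; (iii) for distinct $x,y\in H(1_T)$ there exist open neighbourhoods $U(x)$ and $U(y)$ of $x$ and $y$ in $T$, respectively, such that $a-b\neq c-d$ for every $(a,b)\in U(x)\cap\mathscr{C}_{\mathbb{Z}}$ and every $(c,d)\in U(y)\cap\mathscr{C}_{\mathbb{Z}}$; (iv) the group $H(1_T)$ is torsion free; (v) the group of units $H(1_T)$ is a discrete subgroup in $T$; (vi) the group of units $H(1_T)$ is isomorphic to the infinite cyclic group; (vii) every non-identity element of the group of units $H(1_T)$ is not topologically periodic in the semigroup $T$.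
   Context: The extended bicyclic semigroup $\mathscr{C}_{\mathbb{Z}}$ is the set $\mathbb{Z}\times\mathbb{Z}$ with the operation $(a,b)\cdot(c,d)=(a-b+c,d)$ if $b<c$; $(a,b)\cdot(c,d)=(a,d)$ if $b=c$; $(a,b)\cdot(c,d)=(a,d+b-c)$ if $b>c$. $E(S)$ denotes the set of idempotents of a semigroup $S$. A topological semigroup is a Hausdorff topological space with a jointly continuous semigroup operation; a topological monoid is a topological semigroup with a unit. An element $s$ of a topological semigroup $S$ is topologically periodic if for every open neighbourhood $U(s)$ of $s$ in $S$ there exists an integer $n\geqslant 2$ such that $s^n\in U(s)$. *)

theory Defs
  imports "HOL-Analysis.Analysis" "HOL-Algebra.Elementary_Groups"
begin

text \<open>The operation of the extended bicyclic semigroup, whose underlying set is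
  \<^typ>\<open>int \<times> int\<close>. It has no unit.\<close>

fun ebic_mult :: "int \<times> int \<Rightarrow> int \<times> int \<Rightarrow> int \<times> int" (infixl \<open>\<odot>\<close> 70) where
  "(a, b) \<odot> (c, d) =
     (if b < c then (a - b + c, d) else if b = c then (a, d) else (a, d + b - c))"

interpretation ebic: semigroup ebic_mult
  by standard (auto split: prod.splits)

definition idempotents :: "('s \<Rightarrow> 's \<Rightarrow> 's) \<Rightarrow> 's set" where
  "idempotents f = {x. f x x = x}"

text \<open>A copy of the extended bicyclic semigroup inside \<open>T\<close>, given by its embedding. No topology
  on the semigroup is assumed: it carries whatever topology \<open>T\<close> induces on the copy.\<close>

definition dense_ebic_embedding :: "(int \<times> int \<Rightarrow> 't::{topological_space, times}) \<Rightarrow> bool" where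
  "dense_ebic_embedding h \<longleftrightarrow>
     inj h \<and> (\<forall>p q. h (p \<odot> q) = h p * h q) \<and> closure (range h) = UNIV"

text \<open>The type-class monoid on \<open>'t\<close> as an algebraic structure with explicit carrier, which gives
  access to \<^const>\<open>Units\<close> and \<^const>\<open>units_of\<close>.\<close>

definition type_monoid :: "'t::monoid_mult monoid" where
  "type_monoid = \<lparr>carrier = UNIV, monoid.mult = (*), one = 1\<rparr>"

definition torsion_free :: "('g, 'm) monoid_scheme \<Rightarrow> bool" where
  "torsion_free G \<longleftrightarrow>
     (\<forall>x\<in>carrier G. \<forall>n::nat. n > 0 \<and> x [^]\<^bsub>G\<^esub> n = \<one>\<^bsub>G\<^esub> \<longrightarrow> x = \<one>\<^bsub>G\<^esub>)"

definition topologically_periodic :: "'t::topological_monoid_mult \<Rightarrow> bool" where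
  "topologically_periodic s \<longleftrightarrow> (\<forall>U. open U \<and> s \<in> U \<longrightarrow> (\<exists>n::nat. n \<ge> 2 \<and> s ^ n \<in> U))"

end

theory Submission
  imports Defs
begin

text \<open>The map \<open>(a, b) \<mapsto> a - b\<close> is a homomorphism from the extended bicyclic semigroup to the
  integers. Near the unit of \<open>T\<close> only idempotents occur, that is, elements of value 0. By continuity
  of the multiplication at \<open>(x, x\<inverse>)\<close> the map is then constant near every unit \<open>x\<close>, which extends it
  to a homomorphism from the group of units to the integers. It is injective: a unit of value 0 is
  a limit of idempotents, hence an idempotent, hence 1. So the group of units embeds into the
  integers by a locally constant map, and everything follows.\<close>

section \<open>The map to the integers, and groups that embed into the integers\<close>

lemma ebic_mult_diff:
  assumes "(a, b) \<odot> (c, d) = (p, q)"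
  shows "p - q = (a - b) + (c - d)"
  using assms by (auto split: if_splits)

text \<open>The image of \<open>f\<close> is a nonzero subgroup of the integers, so its least
  positive element \<open>n\<close> generates it; by injectivity a preimage \<open>g\<close> of
  \<open>n\<close> generates the group.\<close>

lemma (in group) iso_integer_groupI:
  assumes hom: "f \<in> hom G integer_group"
    and inj: "inj_on f (carrier G)"
    and ne: "carrier G \<noteq> {\<one>}"
  shows "G \<cong> integer_group"
proof -
  interpret f: group_hom G integer_group f
    by (simp add: group_hom_def group_hom_axioms_def hom is_group)
  have pow: "f (x [^] n) = n * f x" if "x \<in> carrier G" for x and n :: int
    using f.hom_int_pow[of x n] that by simp
  obtain x where x: "x \<in> carrier G" "x \<noteq> \<one>"
    using ne by blast
  then have "f x \<noteq> 0"
    using inj f.hom_one by (metis inj_onD one_closed one_integer_group)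
  \<comment> \<open>Passing to the inverse where necessary makes the value positive, so that the
    minimum below exists.\<close>
  let ?y = "if f x > 0 then x else inv x"
  have "?y \<in> carrier G" and "f ?y = int (nat \<bar>f x\<bar>)" "nat \<bar>f x\<bar> > 0"
    using x(1) \<open>f x \<noteq> 0\<close> by auto
  define P where "P n \<longleftrightarrow> n > 0 \<and> (\<exists>y\<in>carrier G. f y = int n)" for n
  define n where "n = (LEAST n. P n)"
  have "P (nat \<bar>f x\<bar>)"
    unfolding P_def using \<open>?y \<in> carrier G\<close> \<open>f ?y = int (nat \<bar>f x\<bar>)\<close> \<open>nat \<bar>f x\<bar> > 0\<close> by blast
  then have "P n"
    unfolding n_def by (rule LeastI)
  then obtain g where n: "n > 0" and g: "g \<in> carrier G" "f g = int n"
    unfolding P_def by blast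
  have "y = g [^] (f y div int n)" if y: "y \<in> carrier G" for y
  proof -
    \<comment> \<open>Division with remainder: dividing out a power of \<open>g\<close> leaves an
      element whose value is the remainder of \<open>f y\<close> modulo \<open>n\<close>. By
      minimality of \<open>n\<close> this remainder is 0.\<close>
    have "f (y \<otimes> g [^] (- (f y div int n))) = f y mod int n"
      using y g pow[of g "- (f y div int n)"] by (simp add: minus_div_mult_eq_mod)
    moreover have "y \<otimes> g [^] (- (f y div int n)) \<in> carrier G"
      using y g(1) by blast
    moreover have "f y mod int n = int (nat (f y mod int n))"
      using n by simp
    ultimately have "\<exists>z\<in>carrier G. f z = int (nat (f y mod int n))"
      by metis
    moreover have "nat (f y mod int n) < n"
      using n by (simp add: nat_less_iff)
    moreover have "\<not> P (nat (f y mod int n))"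
      using \<open>nat (f y mod int n) < n\<close> not_less_Least unfolding n_def by blast
    ultimately have "\<not> nat (f y mod int n) > 0"
      unfolding P_def by metis
    then have "f y mod int n = 0"
      using n pos_mod_sign[of "int n" "f y"] by linarith
    then have "f (g [^] (f y div int n)) = f y"
      using pow g by (auto simp: mod_0_imp_dvd)
    then show ?thesis
      using inj y g(1) by (metis inj_onD int_pow_closed)
  qed
  moreover have "inj (\<lambda>k::int. g [^] k)"
  proof (rule injI)
    fix k l :: int
    assume "g [^] k = g [^] l"
    then have "k * int n = l * int n"
      using pow[OF g(1)] g(2) by metis
    then show "k = l"
      using n by simp
  qed
  ultimately have "bij_betw (\<lambda>k::int. g [^] k) UNIV (carrier G)"
    using g(1) by (auto simp: bij_betw_def)
  then have "(\<lambda>k::int. g [^] k) \<in> iso integer_group G"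
    using hom_integer_group_pow[OF g(1)] by (simp add: iso_def)
  then show ?thesis
    using group.iso_sym[OF group_integer_group] by (auto simp: is_iso_def)
qed

section \<open>Joint continuity and the units of the monoid\<close>

lemma open_times_elim:
  fixes x y :: "'a::topological_semigroup_mult"
  assumes "open W" "x * y \<in> W"
  obtains U V where "open U" "open V" "x \<in> U" "y \<in> V" "\<And>u v. u \<in> U \<Longrightarrow> v \<in> V \<Longrightarrow> u * v \<in> W"
proof -
  have "open ((\<lambda>p::'a \<times> 'a. fst p * snd p) -` W)"
    using assms(1) by (intro open_vimage continuous_intros)
  moreover have "(x, y) \<in> (\<lambda>p::'a \<times> 'a. fst p * snd p) -` W"
    using assms(2) by simp
  ultimately obtain U V where "open U" "open V" "(x, y) \<in> U \<times> V"
    "U \<times> V \<subseteq> (\<lambda>p::'a \<times> 'a. fst p * snd p) -` W"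
    by (rule open_prod_elim)
  then show ?thesis
    by (intro that[of U V]) auto
qed

interpretation type_monoid: monoid "type_monoid :: 't::monoid_mult monoid"
  by unfold_locales (auto simp: type_monoid_def mult.assoc)

lemma type_monoid_simps [simp]:
  "carrier (type_monoid :: 't::monoid_mult monoid) = UNIV"
  "x \<otimes>\<^bsub>type_monoid\<^esub> y = x * (y :: 't)"
  "\<one>\<^bsub>type_monoid\<^esub> = (1 :: 't)"
  by (simp_all add: type_monoid_def)

lemma Units_type_monoid: "Units type_monoid = {x :: 't::monoid_mult. \<exists>y. y * x = 1 \<and> x * y = 1}"
  by (simp add: Units_def)

lemma one_in_Units_type_monoid [simp]: "(1 :: 't::monoid_mult) \<in> Units type_monoid"
  by (simp add: Units_type_monoid)

lemma subgroup_Units_type_monoid: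
  "subgroup (Units type_monoid) (type_monoid :: 't::monoid_mult monoid)"
  using type_monoid.Units_m_closed by unfold_locales auto

lemma units_of_type_monoid_simps [simp]:
  "carrier (units_of (type_monoid :: 't::monoid_mult monoid)) = Units type_monoid"
  "x \<otimes>\<^bsub>units_of type_monoid\<^esub> y = x * (y :: 't)"
  "\<one>\<^bsub>units_of type_monoid\<^esub> = (1 :: 't)"
  by (simp_all add: units_of_def)

lemma pow_units_of_type_monoid [simp]:
  "x [^]\<^bsub>units_of type_monoid\<^esub> n = (x :: 't::monoid_mult) ^ (n :: nat)"
  \<comment> \<open>\<open>[^]\<close> multiplies by \<open>x\<close> on the right, \<open>^\<close>
    on the left; \<open>power_commutes\<close> reconciles them.\<close>
  by (induction n) (simp_all add: nat_pow_def units_of_def power_commutes)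

lemma power_Units_type_monoid:
  assumes "(x :: 't::monoid_mult) \<in> Units type_monoid"
  shows "x ^ n \<in> Units type_monoid"
  using type_monoid.Units_m_closed[OF assms] by (induction n) simp_all

lemma idempotent_unit_eq_1:
  assumes "(x :: 't::monoid_mult) \<in> Units type_monoid" "x * x = x"
  shows "x = 1"
  using assms type_monoid.Units_l_cancel[of x x 1] by simp

section \<open>The index: extending \<open>a - b\<close> from the dense copy to the units\<close>

locale dense_ebic =
  fixes h :: "int \<times> int \<Rightarrow> 't::{topological_monoid_mult, t2_space}"
  assumes emb: "dense_ebic_embedding h"
begin

lemma h_mult: "h p * h q = h (p \<odot> q)"
  using emb unfolding dense_ebic_embedding_def by metis

lemma h_eq_iff [simp]: "h p = h q \<longleftrightarrow> p = q"
  using emb by (auto simp: dense_ebic_embedding_def dest: injD)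

lemma open_meets_range:
  assumes "open U" "x \<in> U"
  obtains a b where "h (a, b) \<in> U"
proof -
  have "closure (range h) = UNIV"
    using emb unfolding dense_ebic_embedding_def by blast
  then have "U \<inter> range h \<noteq> {}"
    using open_Int_closure_eq_empty[OF assms(1), of "range h"] assms(2) by auto
  then show ?thesis
    using that by auto
qed

lemma one_nhd_idempotents:
  obtains U where "open U" "1 \<in> U" "\<And>a b. h (a, b) \<in> U \<Longrightarrow> a = b"
proof
  \<comment> \<open>\<open>(0, 0) \<odot> (a, b) \<odot> (0, 0)\<close> is fixed by neither left nor right multiplication by \<open>(1, 1)\<close> iff
    \<open>a = b \<le> 0\<close>.\<close>
  let ?e = "\<lambda>x. h (0, 0) * x * h (0, 0)"
  let ?U = "{x. h (1, 1) * ?e x \<noteq> ?e x} \<inter> {x. ?e x * h (1, 1) \<noteq> ?e x}"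
  \<comment> \<open>In a Hausdorff space two continuous maps differ on an open set.\<close>
  show "open ?U"
    by (intro open_Int open_Collect_neq continuous_intros)
  \<comment> \<open>At 1 the sandwiched element is \<open>h (0, 0)\<close>, which
    \<open>h (1, 1)\<close> sends to \<open>h (1, 1)\<close> from either side.\<close>
  show "1 \<in> ?U"
    by (simp add: h_mult)
  show "a = b" if "h (a, b) \<in> ?U" for a b
    using that by (auto simp: h_mult split: if_splits)
qed

text \<open>A relation on all of the monoid rather than a function: uniqueness comes from density,
  while existence is established only for units.\<close>

definition has_index :: "'t \<Rightarrow> int \<Rightarrow> bool" where
  "has_index x k \<longleftrightarrow> (\<exists>U. open U \<and> x \<in> U \<and> (\<forall>a b. h (a, b) \<in> U \<longrightarrow> a - b = k))"

text \<open>Density supplies points of the copy so close to \<open>x\<close> and \<open>y\<close>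
  that their product is close to \<open>x * y\<close>; on the copy the values add.\<close>

lemma has_index_mult:
  assumes "has_index x k" "has_index y l" "has_index (x * y) m"
  shows "m = k + l"
proof -
  obtain U where U: "open U" "x \<in> U" "\<And>a b. h (a, b) \<in> U \<Longrightarrow> a - b = k"
    using assms(1) unfolding has_index_def by blast
  obtain V where V: "open V" "y \<in> V" "\<And>a b. h (a, b) \<in> V \<Longrightarrow> a - b = l"
    using assms(2) unfolding has_index_def by blast
  obtain W where W: "open W" "x * y \<in> W" "\<And>a b. h (a, b) \<in> W \<Longrightarrow> a - b = m"
    using assms(3) unfolding has_index_def by blast
  obtain U' V' where U': "open U'" "x \<in> U'" and V': "open V'" "y \<in> V'"
    and W': "\<And>u v. u \<in> U' \<Longrightarrow> v \<in> V' \<Longrightarrow> u * v \<in> W"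
    using open_times_elim[OF W(1,2)] by metis
  obtain a b where ab: "h (a, b) \<in> U \<inter> U'"
    using open_meets_range[of "U \<inter> U'" x] U U' by auto
  obtain c d where cd: "h (c, d) \<in> V \<inter> V'"
    using open_meets_range[of "V \<inter> V'" y] V V' by auto
  obtain p q where pq: "(a, b) \<odot> (c, d) = (p, q)"
    by (rule prod.exhaust)
  have "h (a, b) * h (c, d) \<in> W"
    using W' ab cd by blast
  then have "p - q = m"
    using W(3) by (simp only: h_mult pq)
  moreover have "a - b = k" "c - d = l"
    using U(3) V(3) ab cd by blast+
  ultimately show ?thesis
    using ebic_mult_diff[OF pq] by simp
qed

lemma has_index_unique:
  assumes "has_index x k" "has_index x l"
  shows "k = l"
proof -
  obtain U where U: "open U" "x \<in> U" "\<And>a b. h (a, b) \<in> U \<Longrightarrow> a - b = k"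
    using assms(1) unfolding has_index_def by blast
  obtain V where V: "open V" "x \<in> V" "\<And>a b. h (a, b) \<in> V \<Longrightarrow> a - b = l"
    using assms(2) unfolding has_index_def by blast
  obtain a b where "h (a, b) \<in> U \<inter> V"
    using open_meets_range[of "U \<inter> V" x] U V by auto
  then show ?thesis
    using U(3) V(3) by blast
qed

text \<open>Fix one point \<open>(c, d)\<close> of the copy near the inverse of \<open>x\<close>.
  Its product with any \<open>(a, b)\<close> near \<open>x\<close> is close to 1, hence of value 0,
  which forces \<open>a - b = d - c\<close>.\<close>

lemma Units_has_index:
  assumes "x \<in> Units type_monoid"
  shows "\<exists>k. has_index x k"
proof -
  obtain y where y: "x * y = 1"
    using assms by (auto simp: Units_type_monoid)
  obtain W where W: "open W" "1 \<in> W" "\<And>a b. h (a, b) \<in> W \<Longrightarrow> a = b"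
    using one_nhd_idempotents by metis
  obtain U V where UV: "open U" "x \<in> U" "open V" "y \<in> V"
    "\<And>u v. u \<in> U \<Longrightarrow> v \<in> V \<Longrightarrow> u * v \<in> W"
    using open_times_elim[of W x y] W y by metis
  obtain c d where cd: "h (c, d) \<in> V"
    using open_meets_range UV by metis
  have "a - b = d - c" if "h (a, b) \<in> U" for a b
  proof -
    obtain p q where pq: "(a, b) \<odot> (c, d) = (p, q)"
      by (rule prod.exhaust)
    have "h (a, b) * h (c, d) \<in> W"
      using UV(5) that cd by blast
    then have "p = q"
      using W(3) by (simp only: h_mult pq)
    then show ?thesis
      using ebic_mult_diff[OF pq] by simp
  qed
  then show ?thesis
    using UV unfolding has_index_def by blast
qed

text \<open>Non-idempotents form an open set, so one at \<open>x\<close> would yield a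
  non-idempotent \<open>(a, a)\<close> in the copy.\<close>

lemma has_index_0_idempotent:
  assumes "has_index x 0"
  shows "x * x = x"
proof (rule ccontr)
  assume "x * x \<noteq> x"
  obtain U where U: "open U" "x \<in> U" "\<And>a b. h (a, b) \<in> U \<Longrightarrow> a = b"
    using assms by (fastforce simp: has_index_def)
  have "open {x::'t. x * x \<noteq> x}"
    by (intro open_Collect_neq continuous_intros)
  then obtain a b where "h (a, b) \<in> U \<inter> {x. x * x \<noteq> x}"
    using open_meets_range[of "U \<inter> {x. x * x \<noteq> x}" x] U \<open>x * x \<noteq> x\<close> by auto
  then show False
    using U(3)[of a b] by (auto simp: h_mult)
qed

text \<open>The value is meaningful only where \<open>has_index\<close> holds for some
  \<open>k\<close>, in particular at every unit.\<close>

definition index :: "'t \<Rightarrow> int" where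
  "index x = (THE k. has_index x k)"

lemma index_eq: "has_index x k \<Longrightarrow> index x = k"
  unfolding index_def using has_index_unique by blast

lemma Units_has_index_index: "x \<in> Units type_monoid \<Longrightarrow> has_index x (index x)"
  using Units_has_index index_eq by metis

lemma index_mult:
  assumes "x \<in> Units type_monoid" "y \<in> Units type_monoid"
  shows "index (x * y) = index x + index y"
  using has_index_mult[of x _ y] assms Units_has_index_index
    type_monoid.Units_m_closed[OF assms, simplified] by blast

lemma index_hom: "index \<in> hom (units_of type_monoid) integer_group"
  by (auto simp: hom_def index_mult)

lemma index_eq_0_imp:
  assumes "x \<in> Units type_monoid" "index x = 0"
  shows "x = 1"
  using assms Units_has_index_index has_index_0_idempotent idempotent_unit_eq_1 by metis

lemma inj_on_index: "inj_on index (Units type_monoid)"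
proof -
  interpret group_hom "units_of type_monoid" integer_group index
    by (simp add: group_hom_def group_hom_axioms_def type_monoid.units_group index_hom)
  show ?thesis
    using inj_on_one_iff index_eq_0_imp by simp
qed

lemma index_power:
  assumes "x \<in> Units type_monoid"
  shows "index (x ^ n) = int n * index x"
proof (induction n)
  case 0
  show ?case
    \<comment> \<open>From \<open>1 * 1 = 1\<close> follows
      \<open>index 1 = index 1 + index 1\<close>.\<close>
    using index_mult[of 1 1] by simp
next
  case (Suc n)
  then show ?case
    using index_mult[OF assms power_Units_type_monoid[OF assms]] by (simp add: algebra_simps)
qed

text \<open>An open set that witnesses the index at \<open>x\<close> witnesses the same index at
  each of its points, whether or not these are units.\<close>

lemma index_locally_constant:
  assumes "x \<in> Units type_monoid"
  obtains U where "open U" "x \<in> U" "\<And>a b. h (a, b) \<in> U \<Longrightarrow> a - b = index x"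
    "\<And>y. y \<in> U \<Longrightarrow> index y = index x"
proof -
  obtain U where U: "open U" "x \<in> U" "\<And>a b. h (a, b) \<in> U \<Longrightarrow> a - b = index x"
    using Units_has_index_index[OF assms] unfolding has_index_def by blast
  then have "has_index y (index x)" if "y \<in> U" for y
    using that unfolding has_index_def by blast
  then show ?thesis
    using that U index_eq by blast
qed

end

section \<open>The neighbourhood of 1 and the structure of the group of units\<close>

theorem lemma3p6:
  fixes h :: "int \<times> int \<Rightarrow> 't::{topological_monoid_mult, t2_space}"
    and H :: "'t set"
  assumes emb: "dense_ebic_embedding h"
    and H: "H = Units type_monoid"
  shows "(\<exists>U. open U \<and> 1 \<in> U \<and> U \<inter> range h \<subseteq> h ` idempotents (\<odot>)) \<and>
    (\<not> is_singleton H \<longrightarrow>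
      (\<forall>x\<in>H. \<exists>U. open U \<and> x \<in> U \<and>
         (\<forall>a b c d. h (a, b) \<in> U \<and> h (c, d) \<in> U \<longrightarrow> a - b = c - d)) \<and>
      (\<forall>x\<in>H. \<forall>y\<in>H. x \<noteq> y \<longrightarrow>
         (\<exists>U V. open U \<and> x \<in> U \<and> open V \<and> y \<in> V \<and>
           (\<forall>a b c d. h (a, b) \<in> U \<and> h (c, d) \<in> V \<longrightarrow> a - b \<noteq> c - d))) \<and>
      torsion_free (units_of (type_monoid :: 't monoid)) \<and>
      (subgroup H type_monoid \<and> discrete H) \<and>
      units_of (type_monoid :: 't monoid) \<cong> integer_group \<and>
      (\<forall>x\<in>H. x \<noteq> 1 \<longrightarrow> \<not> topologically_periodic x))"
proof -
  interpret dense_ebic h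
    by unfold_locales (rule emb)
  have index_inj: "x = y" if "x \<in> H" "y \<in> H" "index x = index y" for x y
    using inj_on_index that H by (auto dest: inj_onD)
  have i: "\<exists>U. open U \<and> 1 \<in> U \<and> U \<inter> range h \<subseteq> h ` idempotents (\<odot>)"
  proof -
    obtain U where U: "open U" "1 \<in> U" "\<And>a b. h (a, b) \<in> U \<Longrightarrow> a = b"
      using one_nhd_idempotents by metis
    then have "U \<inter> range h \<subseteq> h ` idempotents (\<odot>)"
      by (fastforce simp: idempotents_def)
    then show ?thesis
      using U by blast
  qed
  have ii: "\<exists>U. open U \<and> x \<in> U \<and> (\<forall>a b c d. h (a, b) \<in> U \<and> h (c, d) \<in> U \<longrightarrow> a - b = c - d)"
    if "x \<in> H" for x
    using that index_locally_constant H by metis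
  have iii: "\<exists>U V. open U \<and> x \<in> U \<and> open V \<and> y \<in> V \<and>
      (\<forall>a b c d. h (a, b) \<in> U \<and> h (c, d) \<in> V \<longrightarrow> a - b \<noteq> c - d)"
    if "x \<in> H" "y \<in> H" "x \<noteq> y" for x y
  proof -
    have "index x \<noteq> index y"
      using index_inj that by blast
    then show ?thesis
      using index_locally_constant that H by metis
  qed
  have iv: "torsion_free (units_of (type_monoid :: 't monoid))"
    unfolding torsion_free_def
  proof (intro ballI allI impI)
    fix x :: 't and n :: nat
    assume x: "x \<in> carrier (units_of type_monoid)"
      and "0 < n \<and> x [^]\<^bsub>units_of type_monoid\<^esub> n = \<one>\<^bsub>units_of type_monoid\<^esub>"
    then have "n > 0" "x ^ n = 1"
      by simp_all
    then have "int n * index x = 0"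
      \<comment> \<open>The instance with exponent 0 supplies \<open>index 1 = 0\<close>.\<close>
      using index_power[of x n] index_power[of x 0] x by simp
    then show "x = \<one>\<^bsub>units_of type_monoid\<^esub>"
      using index_eq_0_imp[of x] x \<open>n > 0\<close> by simp
  qed
  have v: "discrete H"
  proof (rule discreteI)
    fix x assume x: "x \<in> H"
    obtain U where U: "open U" "x \<in> U" "\<And>y. y \<in> U \<Longrightarrow> index y = index x"
      using index_locally_constant x H by metis
    \<comment> \<open>The index is constant on \<open>U\<close> but injective on
      \<open>H\<close>.\<close>
    then have "U \<inter> H = {x}"
      using x index_inj by auto
    then show "x isolated_in H"
      using U x by (auto simp: isolated_in_def)
  qed
  have vi: "units_of (type_monoid :: 't monoid) \<cong> integer_group" if "\<not> is_singleton H"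
    using group.iso_integer_groupI[OF type_monoid.units_group index_hom] inj_on_index that H
    by (auto simp: is_singleton_def)
  have vii: "\<not> topologically_periodic x" if x: "x \<in> H" "x \<noteq> 1" for x
  proof
    assume "topologically_periodic x"
    moreover obtain U where "open U" "x \<in> U" "\<And>y. y \<in> U \<Longrightarrow> index y = index x"
      using index_locally_constant x H by metis
    \<comment> \<open>A power of \<open>x\<close> returns to the neighbourhood of constant index, so
      \<open>n * index x = index x\<close> with \<open>n\<close> at least 2, which forces index
      0.\<close>
    ultimately obtain n where "n \<ge> 2" "index (x ^ n) = index x"
      unfolding topologically_periodic_def by metis
    then have "index x = 0"
      using index_power x H by simp
    then show False
      using index_eq_0_imp x H by blast
  qed
  have "subgroup H type_monoid"
    unfolding H by (rule subgroup_Units_type_monoid)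
  then show ?thesis
    by (intro conjI impI ballI i ii iii iv v vi vii)
qed

end
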